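(* Let $\ell\ge1$ and let $G_\ell$ be the graph obtained from a path $p_1p_2\cdots p_\ell$ and a copy of $K_{2,3}$ with parts $\{x_1,x_2\}$ and $\{y_1,y_2,y_3\}$ by adding the edge $y_1p_1$; let $G_\ell+e$ be obtained from $G_\ell$ by adding the edge $x_1x_2$. Let $G$ be $G_\ell$ or $G_\ell+e$ and $A\in\mathcal{S}(G)$. Then the sum of the multiplicities of any two distinct eigenvalues of $A$ is at most $4$.
   Context: $\mathcal{S}(G)$ is the set of real symmetric matrices $A=(a_{ij})$ indexed by $V(G)$ with $a_{ij}\neq0$ iff $ij\in E(G)$ for $i\ne j$ (diagonal arbitrary). *)

theory Defs
  imports "Jordan_Normal_Form.Char_Poly"
begin

text \<open>
  A finite simple graph is given by its number of vertices \<open>n\<close>, the vertex set being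
  \<open>{0..<n}\<close>, and its set \<open>E\<close> of edges, which are two-element subsets of the vertex set.
\<close>

definition sym_pattern_mats :: "nat \<Rightarrow> nat set set \<Rightarrow> real mat set" where
  "sym_pattern_mats n E =
     {A \<in> carrier_mat n n. transpose_mat A = A \<and>
        (\<forall>i<n. \<forall>j<n. i \<noteq> j \<longrightarrow> (A $$ (i, j) \<noteq> 0 \<longleftrightarrow> {i, j} \<in> E))}"

text \<open>
  Numbering of the vertices of \<open>G\<^sub>l\<close>: \<open>x\<^sub>1, x\<^sub>2\<close> are \<open>0, 1\<close>;
  \<open>y\<^sub>1, y\<^sub>2, y\<^sub>3\<close> are \<open>2, 3, 4\<close>; and \<open>p\<^sub>1, \<dots>, p\<^sub>l\<close> are
  \<open>5, \<dots>, l + 4\<close>. The indices of the vertex functions start at 1.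
\<close>

definition vx :: "nat \<Rightarrow> nat" where "vx i = i - 1"
definition vy :: "nat \<Rightarrow> nat" where "vy j = j + 1"
definition vp :: "nat \<Rightarrow> nat" where "vp k = k + 4"

definition G_order :: "nat \<Rightarrow> nat" where
  "G_order l = l + 5"

definition G_edges :: "nat \<Rightarrow> nat set set" where
  "G_edges l =
     {{vp k, vp (k + 1)} | k. 1 \<le> k \<and> k < l}
     \<union> {{vx i, vy j} | i j. i \<in> {1..2} \<and> j \<in> {1..3}}
     \<union> {{vy 1, vp 1}}"

definition G_plus_e_edges :: "nat \<Rightarrow> nat set set" where
  "G_plus_e_edges l = insert {vx 1, vx 2} (G_edges l)"

definition eig_mult :: "real mat \<Rightarrow> real \<Rightarrow> nat" where
  "eig_mult A ev = Polynomial.order ev (char_poly A)"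

end

theory Submission
  imports Defs "Jordan_Normal_Form.Jordan_Normal_Form_Uniqueness"
    "Jordan_Normal_Form.Jordan_Normal_Form_Existence"
begin

text \<open>For a symmetric matrix, if the multiplicity of an eigenvalue exceeds the size of a set of
  coordinates, some eigenvector vanishes on that set. An eigenvector that vanishes at the end of
  the path vanishes on the whole path and at \<open>y\<^sub>1\<close>, so it lives on \<open>x\<^sub>1, x\<^sub>2, y\<^sub>2, y\<^sub>3\<close> and its
  \<open>x\<close>-part is orthogonal to the \<open>y\<^sub>1\<close>-row, that is, lies on a fixed line. If \<open>\<nu>\<close> has multiplicity
  at least 3, then \<open>y\<^sub>2\<close> and \<open>y\<^sub>3\<close> have diagonal entry \<open>\<nu>\<close> and their rows are orthogonal to
  that line. If \<open>\<mu> \<noteq> \<nu>\<close> had multiplicity at least 2, a vector on the line would be an eigenvector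
  for \<open>\<mu>\<close> of the block on \<open>x\<^sub>1, x\<^sub>2\<close>; pairing it with the \<open>\<nu>\<close>-equations yields \<open>\<mu> = \<nu>\<close>.\<close>

section \<open>Spectral theory of real symmetric matrices\<close>

lemma symmetric_scalar_prod:
  fixes A :: "'a :: comm_semiring_0 mat"
  assumes "A \<in> carrier_mat n n" and "transpose_mat A = A"
    and "v \<in> carrier_vec n" and "w \<in> carrier_vec n"
  shows "(A *\<^sub>v v) \<bullet> w = v \<bullet> (A *\<^sub>v w)"
  using transpose_vec_mult_scalar[of A n n w v] assms
  by (metis comm_scalar_prod mult_mat_vec_carrier)

lemma mult_of_real_mat_conjugate:
  fixes A :: "real mat"
  assumes "A \<in> carrier_mat n n" and "v \<in> carrier_vec n"
  shows "map_mat complex_of_real A *\<^sub>v conjugate v = conjugate (map_mat complex_of_real A *\<^sub>v v)"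
proof (rule eq_vecI)
  fix i assume "i < dim_vec (conjugate (map_mat complex_of_real A *\<^sub>v v))"
  then show "(map_mat complex_of_real A *\<^sub>v conjugate v) $ i
      = conjugate (map_mat complex_of_real A *\<^sub>v v) $ i"
    using assms by (auto simp: scalar_prod_def)
qed (use assms in auto)

text \<open>Moving the matrix across the Hermitian product of an eigenvector \<open>v\<close> with
  itself gives \<open>a\<close> times its norm on one side and \<open>cnj a\<close> times it on the
  other.\<close>

lemma symmetric_eigenvalue_real:
  fixes A :: "real mat"
  assumes A: "A \<in> carrier_mat n n" and sym: "transpose_mat A = A"
    and ev: "eigenvalue (map_mat complex_of_real A) a"
  shows "a \<in> \<real>"
proof -
  let ?A = "map_mat complex_of_real A"
  have cA: "?A \<in> carrier_mat n n" using A by simp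
  have csym: "transpose_mat ?A = ?A" using sym by (metis map_mat_transpose)
  from ev cA obtain v where v: "v \<in> carrier_vec n" "v \<noteq> 0\<^sub>v n" "?A *\<^sub>v v = a \<cdot>\<^sub>v v"
    unfolding eigenvalue_def eigenvector_def by auto
  have cv: "conjugate v \<in> carrier_vec n" using v by simp
  have "a * (v \<bullet>c v) = (?A *\<^sub>v v) \<bullet>c v" using v cv by simp
  also have "\<dots> = v \<bullet> (?A *\<^sub>v conjugate v)"
    by (rule symmetric_scalar_prod[OF cA csym v(1) cv])
  also have "\<dots> = v \<bullet> conjugate (a \<cdot>\<^sub>v v)"
    using mult_of_real_mat_conjugate[OF A v(1)] v(3) by simp
  also have "\<dots> = cnj a * (v \<bullet>c v)"
    using v cv by (simp add: conjugate_smult_vec)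
  finally have "a = cnj a" using v conjugate_square_eq_0_vec[OF v(1)] by simp
  then show ?thesis by (metis Reals_cnj_iff)
qed

text \<open>All complex roots are real, so the complex factorization descends through the injective
  embedding. The splitting provides a Jordan form over the reals.\<close>

lemma symmetric_char_poly_splits:
  fixes A :: "real mat"
  assumes A: "A \<in> carrier_mat n n" and sym: "transpose_mat A = A"
  shows "\<exists>as. char_poly A = (\<Prod>a \<leftarrow> as. [:- a, 1:])"
proof -
  let ?A = "map_mat complex_of_real A"
  have cA: "?A \<in> carrier_mat n n" using A by simp
  interpret h: map_poly_inj_idom_hom complex_of_real ..
  obtain as where as: "char_poly ?A = (\<Prod>a \<leftarrow> as. [:- a, 1:])"
    using char_poly_factorized[OF cA] by blast
  have "a \<in> \<real>" if "a \<in> set as" for a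
  proof (rule symmetric_eigenvalue_real[OF A sym])
    have "poly (char_poly ?A) a = 0"
      unfolding as using that by (induct as) auto
    then show "eigenvalue ?A a" using eigenvalue_root_char_poly[OF cA] by simp
  qed
  then have "as = map complex_of_real (map Re as)"
    by (auto simp: comp_def intro!: map_idI[symmetric])
  then have "map_poly complex_of_real (char_poly A)
      = (\<Prod>a \<leftarrow> map complex_of_real (map Re as). [:- a, 1:])"
    using of_real_hom.char_poly_hom[OF A] as by metis
  also have "\<dots> = map_poly complex_of_real (\<Prod>a \<leftarrow> map Re as. [:- a, 1:])"
    by (simp add: h.hom_prod_list comp_def hom_distribs)
  finally show ?thesis using h.injectivity by blast
qed

text \<open>If \<open>C (C v) = 0\<close>, then by symmetry the squared norm of \<open>C v\<close>
  equals \<open>v \<bullet> C (C v) = 0\<close>. This excludes generalized eigenvectors that are not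
  eigenvectors.\<close>

lemma mat_kernel_symmetric_pow:
  fixes C :: "real mat"
  assumes C: "C \<in> carrier_mat n n" and sym: "transpose_mat C = C"
  shows "mat_kernel (C ^\<^sub>m Suc k) = mat_kernel C"
proof (induct k)
  case 0
  then show ?case using C by simp
next
  case (Suc k)
  have P: "C ^\<^sub>m Suc k \<in> carrier_mat n n" "C ^\<^sub>m Suc (Suc k) \<in> carrier_mat n n"
    using C by (auto intro: pow_carrier_mat)
  have pow: "C ^\<^sub>m Suc (Suc k) *\<^sub>v v = C ^\<^sub>m Suc k *\<^sub>v (C *\<^sub>v v)" if "v \<in> carrier_vec n" for v
    using assoc_mult_mat_vec[OF P(1) C that] by simp
  show ?case
  proof (intro equalityI subsetI)
    fix v assume "v \<in> mat_kernel (C ^\<^sub>m Suc (Suc k))"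
    then have v: "v \<in> carrier_vec n" and "C ^\<^sub>m Suc k *\<^sub>v (C *\<^sub>v v) = 0\<^sub>v n"
      using mat_kernelD[OF P(2)] pow by auto
    \<comment> \<open>The induction hypothesis, applied to \<open>C v\<close>, brings the power down
      to the square of \<open>C\<close>.\<close>
    then have "C *\<^sub>v v \<in> mat_kernel C"
      using C Suc mat_kernelI[OF P(1)] by auto
    then have "C *\<^sub>v (C *\<^sub>v v) = 0\<^sub>v n" using mat_kernelD[OF C] by auto
    then have "(C *\<^sub>v v) \<bullet>c (C *\<^sub>v v) = 0"
      using symmetric_scalar_prod[OF C sym v, of "C *\<^sub>v v"] C v by simp
    then have "C *\<^sub>v v = 0\<^sub>v n"
      using conjugate_square_eq_0_vec[of "C *\<^sub>v v" n] C v by simp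
    then show "v \<in> mat_kernel C" using mat_kernelI[OF C v] by simp
  next
    fix v assume "v \<in> mat_kernel C"
    then have v: "v \<in> carrier_vec n" and "C *\<^sub>v v = 0\<^sub>v n" using mat_kernelD[OF C] by auto
    then have "C ^\<^sub>m Suc (Suc k) *\<^sub>v v = C ^\<^sub>m Suc k *\<^sub>v 0\<^sub>v n" using pow by simp
    also have "\<dots> = 0\<^sub>v n" using P(1) by (intro eq_vecI) (auto simp: scalar_prod_def)
    finally show "v \<in> mat_kernel (C ^\<^sub>m Suc (Suc k))" by (rule mat_kernelI[OF P(2) v])
  qed
qed

text \<open>The algebraic multiplicity is the total size of the Jordan blocks of \<open>ev\<close>,
  which is the kernel dimension of a high power of \<open>?C\<close>; that power has the same kernel
  as \<open>?C\<close> itself.\<close>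

lemma symmetric_kernel_dim_eq_order:
  fixes A :: "real mat"
  assumes A: "A \<in> carrier_mat n n" and sym: "transpose_mat A = A"
  shows "kernel.dim n (char_matrix A ev) = Polynomial.order ev (char_poly A)"
proof -
  let ?C = "char_matrix A ev"
  have C: "?C \<in> carrier_mat n n" using A by simp
  have Csym: "transpose_mat ?C = ?C"
  proof (rule eq_matI)
    fix i j assume ij: "i < dim_row ?C" "j < dim_col ?C"
    have "A $$ (j, i) = A $$ (i, j)"
      using ij A sym by (metis C carrier_matD index_transpose_mat(1))
    then show "transpose_mat ?C $$ (i, j) = ?C $$ (i, j)"
      using ij A unfolding char_matrix_def by auto
  qed (use C in auto)
  obtain n_as where jnf: "jordan_nf A n_as"
    using symmetric_char_poly_splits[OF A sym] jordan_nf_exists[OF A] by blast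
  \<comment> \<open>The sum bounds every block size, so each minimum with \<open>Suc k\<close> below
    is the full size of the block.\<close>
  define k where "k = sum_list (map fst n_as)"
  have le: "fst na \<le> Suc k" if "na \<in> set n_as" for na
    using member_le_sum_list[of "fst na" "map fst n_as"] that unfolding k_def by force
  have "kernel.dim n ?C = kernel_dim (?C ^\<^sub>m Suc k)"
    unfolding kernel_dim_def mat_kernel_symmetric_pow[OF C Csym] using C by simp
  also have "\<dots> = (\<Sum>m \<leftarrow> map fst [(m, e) \<leftarrow> n_as . e = ev]. min (Suc k) m)"
    using dim_gen_eigenspace[OF jnf] unfolding dim_gen_eigenspace_def .
  also have "\<dots> = sum_list (map fst (filter (\<lambda>na. snd na = ev) n_as))"
    unfolding map_map using le
    by (intro arg_cong[of _ _ sum_list] map_cong filter_cong) (auto simp: min_absorb2)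
  finally show ?thesis using jordan_nf_order[OF jnf] by simp
qed

section \<open>Eigenvectors vanishing on prescribed coordinates\<close>

lemma underdetermined_lincomb:
  fixes X :: "'a :: field vec set"
  assumes "finite X" and "finite S" and card: "card S < card X"
  shows "\<exists>c. (\<exists>x\<in>X. c x \<noteq> 0) \<and> (\<forall>i\<in>S. (\<Sum>x\<in>X. c x * x $ i) = 0)"
proof -
  let ?k = "card X"
  obtain f where f: "bij_betw f {0..<?k} X" using ex_bij_betw_nat_finite[OF \<open>finite X\<close>] by blast
  obtain s where s: "bij_betw s {0..<card S} S" using ex_bij_betw_nat_finite[OF \<open>finite S\<close>] by blast
  \<comment> \<open>The system has fewer equations than unknowns. Zero rows make it square, and row
    \<open>card S\<close> is one of them, so the determinant is zero.\<close>
  define M where "M = mat ?k ?k (\<lambda>(r, j). if r < card S then f j $ s r else 0)"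
  have M: "M \<in> carrier_mat ?k ?k" unfolding M_def by simp
  have "M = mat\<^sub>r ?k ?k (\<lambda>r. if r = card S then 0\<^sub>v ?k else row M r)"
    unfolding M_def by (intro eq_matI) auto
  also have "det \<dots> = 0" by (rule det_row_0[OF card]) (use M in auto)
  finally have "det M = 0" .
  then obtain w where w: "w \<in> carrier_vec ?k" "w \<noteq> 0\<^sub>v ?k" and Mw: "M *\<^sub>v w = 0\<^sub>v ?k"
    using det_0_iff_vec_prod_zero_field[OF M] by blast
  obtain j where j: "j < ?k" "w $ j \<noteq> 0" using w by (metis eq_vecI carrier_vecD index_zero_vec)
  define g where "g = the_inv_into {0..<?k} f"
  have gf: "g (f j) = j" if "j < ?k" for j
    unfolding g_def using f that by (intro the_inv_into_f_f) (auto simp: bij_betw_def)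
  show ?thesis
  proof (intro exI[of _ "\<lambda>x. w $ g x"] conjI bexI ballI)
    show "w $ g (f j) \<noteq> 0" using j gf by simp
    show "f j \<in> X" using f j by (auto simp: bij_betw_def)
    fix i assume "i \<in> S"
    then have "i \<in> s ` {0..<card S}" using bij_betw_imp_surj_on[OF s] by simp
    then obtain r where r: "r < card S" "s r = i" by auto
    have "(\<Sum>x\<in>X. w $ g x * x $ i) = (\<Sum>j\<in>{0..<?k}. w $ g (f j) * f j $ i)"
      by (rule sum.reindex_bij_betw[OF f, symmetric])
    also have "\<dots> = (M *\<^sub>v w) $ r"
      using r card w gf unfolding M_def by (auto simp: scalar_prod_def mult.commute intro!: sum.cong)
    finally show "(\<Sum>x\<in>X. w $ g x * x $ i) = 0" using Mw r card by simp
  qed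
qed

text \<open>The eigenspace has a basis with more than \<open>card S\<close> elements, so some
  nontrivial combination vanishes on \<open>S\<close>; independence keeps it nonzero.\<close>

lemma symmetric_eigenvector_vanishing:
  fixes A :: "real mat"
  assumes A: "A \<in> carrier_mat n n" and sym: "transpose_mat A = A"
    and S: "S \<subseteq> {0..<n}" and card: "card S < Polynomial.order ev (char_poly A)"
  obtains v where "v \<in> carrier_vec n" and "v \<noteq> 0\<^sub>v n" and "A *\<^sub>v v = ev \<cdot>\<^sub>v v"
    and "\<And>i. i \<in> S \<Longrightarrow> v $ i = 0"
proof -
  let ?C = "char_matrix A ev"
  have C: "?C \<in> carrier_mat n n" using A by simp
  interpret K: kernel n n ?C by unfold_locales (rule C)
  obtain X where fin: "finite X" and basis: "K.basis X" using kernel_basis_exists[OF C] by blast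
  have X: "X \<subseteq> mat_kernel ?C" "K.lin_indpt X" using basis unfolding K.Ker.basis_def by auto
  have "card S < card X"
    using card K.Ker.dim_basis[OF fin basis] symmetric_kernel_dim_eq_order[OF A sym] by simp
  then obtain c x where x: "x \<in> X" "c x \<noteq> 0"
    and c: "\<And>i. i \<in> S \<Longrightarrow> (\<Sum>x\<in>X. c x * x $ i) = 0"
    using underdetermined_lincomb[OF fin finite_subset[OF S]] by auto
  let ?v = "K.lincomb c X"
  have v: "?v \<in> mat_kernel ?C" using K.Ker.lincomb_closed[OF X(1)] by simp
  have nz: "?v \<noteq> 0\<^sub>v n"
    using X x fin unfolding K.Ker.lin_dep_def by auto
  have vn: "?v \<in> carrier_vec n" using mat_kernelD[OF C v] by simp
  have "eigenvector A ?v ev"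
    using eigenvector_char_matrix[OF A] vn nz mat_kernelD[OF C v] by simp
  then have "A *\<^sub>v ?v = ev \<cdot>\<^sub>v ?v" unfolding eigenvector_def by simp
  moreover have "?v $ i = 0" if "i \<in> S" for i
    using c[OF that] K.lincomb_index[OF _ X(1), of i c] S that by auto
  ultimately show ?thesis by (rule that[OF vn nz])
qed

section \<open>Adjacency as arithmetic on vertex numbers\<close>

lemma doubleton_eq_ordered:
  fixes i j a b :: "'a :: linorder"
  assumes "{i, j} = {a, b}" and "i < j" and "a < b"
  shows "i = a \<and> j = b"
  using assms by (auto simp: doubleton_eq_iff)

text \<open>The disjuncts \<open>?K\<close>, \<open>?B\<close> and \<open>?P\<close> are the edges
  of the bipartite part, the edge joining it to the path, and the edges of the path.\<close>

lemma G_edges_iff: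
  assumes "i < j"
  shows "{i, j} \<in> G_edges l \<longleftrightarrow>
    i \<le> 1 \<and> 2 \<le> j \<and> j \<le> 4 \<or> i = 2 \<and> j = 5 \<or> 5 \<le> i \<and> j = i + 1 \<and> j < l + 5"
    (is "_ \<longleftrightarrow> ?K \<or> ?B \<or> ?P")
proof
  assume "{i, j} \<in> G_edges l"
  then consider (path) k where "{i, j} = {vp k, vp (k + 1)}" "1 \<le> k" "k < l"
    | (K) a b where "{i, j} = {vx a, vy b}" "1 \<le> a" "a \<le> 2" "1 \<le> b" "b \<le> 3"
    | (bridge) "{i, j} = {vy 1, vp 1}"
    unfolding G_edges_def by auto
  then show "?K \<or> ?B \<or> ?P"
  proof cases
    case path
    then have "i = vp k" "j = vp (k + 1)"
      using doubleton_eq_ordered[OF _ assms, of "vp k" "vp (k + 1)"] by (simp_all add: vp_def)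
    then show ?thesis using path unfolding vp_def by simp
  next
    case K
    then have "vx a < vy b" unfolding vx_def vy_def by linarith
    then have "i = vx a" "j = vy b" using doubleton_eq_ordered[OF K(1) assms] by blast+
    then show ?thesis using K unfolding vx_def vy_def by linarith
  next
    case bridge
    then have "i = vy 1" "j = vp 1"
      using doubleton_eq_ordered[OF _ assms, of "vy 1" "vp 1"] by (simp_all add: vy_def vp_def)
    then show ?thesis unfolding vy_def vp_def by simp
  qed
next
  have "\<exists>a b. {i, j} = {vx a, vy b} \<and> a \<in> {1..2} \<and> b \<in> {1..3}" if ?K
  proof (intro exI conjI)
    show "{i, j} = {vx (i + 1), vy (j - 1)}" using that by (simp add: vx_def vy_def)
    show "i + 1 \<in> {1..2}" "j - 1 \<in> {1..3}" using that by auto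
  qed
  moreover have "\<exists>k. {i, j} = {vp k, vp (k + 1)} \<and> 1 \<le> k \<and> k < l" if ?P
    using that unfolding vp_def by (intro exI[of _ "i - 4"]) auto
  moreover have "{i, j} = {vy 1, vp 1}" if ?B
    using that unfolding vy_def vp_def by auto
  ultimately show "{i, j} \<in> G_edges l" if "?K \<or> ?B \<or> ?P"
    using that unfolding G_edges_def by blast
qed

text \<open>Leaving the entry at \<open>(0, 1)\<close>, for the pair of \<open>x\<close> vertices,
  unconstrained treats both graphs at once.\<close>

locale K23_path_mat =
  fixes l :: nat and A :: "real mat"
  assumes l: "1 \<le> l"
    and A: "A \<in> carrier_mat (l + 5) (l + 5)"
    and sym: "transpose_mat A = A"
    and entry: "\<And>i j. i < j \<Longrightarrow> j < l + 5 \<Longrightarrow> (i, j) \<noteq> (0, 1) \<Longrightarrow>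
      A $$ (i, j) \<noteq> 0 \<longleftrightarrow>
        i \<le> 1 \<and> 2 \<le> j \<and> j \<le> 4 \<or> i = 2 \<and> j = 5 \<or> 5 \<le> i \<and> j = i + 1"
begin

section \<open>Eigenvectors vanishing at the end of the path\<close>

lemma entry_sym: "i < l + 5 \<Longrightarrow> j < l + 5 \<Longrightarrow> A $$ (i, j) = A $$ (j, i)"
  using A sym by (metis carrier_matD index_transpose_mat(1))

lemma eigenvector_row:
  assumes "v \<in> carrier_vec (l + 5)" and "A *\<^sub>v v = ev \<cdot>\<^sub>v v" and "i < l + 5"
  shows "(\<Sum>j<l + 5. A $$ (i, j) * v $ j) = ev * v $ i"
proof -
  have "(A *\<^sub>v v) $ i = (\<Sum>j<l + 5. A $$ (i, j) * v $ j)"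
    using assms(1,3) A by (auto simp: scalar_prod_def atLeast0LessThan intro!: sum.cong)
  then show ?thesis using assms by simp
qed

text \<open>In row \<open>i\<close> only the term of the preceding vertex can survive, and its
  matrix entry is nonzero. The vertex before \<open>p_1\<close>, numbered 5, is \<open>y_1\<close>,
  numbered 2.\<close>

lemma vanish_step:
  assumes v: "v \<in> carrier_vec (l + 5)" "A *\<^sub>v v = ev \<cdot>\<^sub>v v"
    and i: "5 \<le> i" "i < l + 5"
    and zero: "\<And>j. i \<le> j \<Longrightarrow> j < l + 5 \<Longrightarrow> v $ j = 0"
  shows "v $ (if i = 5 then 2 else i - 1) = 0"
proof -
  let ?p = "if i = 5 then 2 else i - 1"
  have p: "?p < i" "?p < l + 5" using i by auto
  have "A $$ (i, j) * v $ j = 0" if "j < l + 5" "j \<noteq> ?p" for j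
  proof (cases "i \<le> j")
    case False
    then have ji: "j < i" "(j, i) \<noteq> (0, 1)" using i by auto
    have "\<not> (j \<le> 1 \<and> 2 \<le> i \<and> i \<le> 4 \<or> j = 2 \<and> i = 5 \<or> 5 \<le> j \<and> i = j + 1)"
      using that i by (auto split: if_splits)
    then have "A $$ (j, i) = 0" using entry[OF ji(1) i(2) ji(2)] by blast
    then show ?thesis using entry_sym[of i j] i that by simp
  qed (use zero that in simp)
  then have "(\<Sum>j<l + 5. A $$ (i, j) * v $ j) = A $$ (i, ?p) * v $ ?p"
    by (subst sum.remove[of _ ?p]) (use p(2) in \<open>simp_all del: mult_eq_0_iff add: sum.neutral\<close>)
  then have "A $$ (i, ?p) * v $ ?p = 0"
    using eigenvector_row[OF v i(2)] zero[of i] i by simp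
  moreover have "A $$ (?p, i) \<noteq> 0"
  proof -
    have "?p = 2 \<and> i = 5 \<or> 5 \<le> ?p \<and> i = ?p + 1" "(?p, i) \<noteq> (0, 1)" using i by auto
    then show ?thesis using entry[OF p(1) i(2)] by blast
  qed
  ultimately show ?thesis using entry_sym[OF i(2) p(2)] by simp
qed

lemma vanish_path:
  assumes v: "v \<in> carrier_vec (l + 5)" "A *\<^sub>v v = ev \<cdot>\<^sub>v v" and last: "v $ (l + 4) = 0"
  shows "5 \<le> i \<Longrightarrow> i < l + 5 \<Longrightarrow> v $ i = 0" and "v $ 2 = 0"
proof -
  have path: "\<forall>j. 5 \<le> j \<and> j < l + 5 \<longrightarrow> v $ j = 0"
  \<comment> \<open>The induction runs downwards from the last path vertex \<open>l + 4\<close> to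
    the first one, 5.\<close>
  proof (rule inc_induct[of 5 "l + 4" "\<lambda>i. \<forall>j. i \<le> j \<and> j < l + 5 \<longrightarrow> v $ j = 0"])
    show "\<forall>j. l + 4 \<le> j \<and> j < l + 5 \<longrightarrow> v $ j = 0"
      using last by (auto simp: le_less_Suc_eq numeral_eq_Suc)
    fix i assume "5 \<le> i" "i < l + 4" "\<forall>j. Suc i \<le> j \<and> j < l + 5 \<longrightarrow> v $ j = 0"
    then show "\<forall>j. i \<le> j \<and> j < l + 5 \<longrightarrow> v $ j = 0"
      using vanish_step[OF v, of "Suc i"] by (auto simp: le_less_Suc_eq dest: le_imp_less_or_eq)
  qed (use l in simp)
  show "5 \<le> i \<Longrightarrow> i < l + 5 \<Longrightarrow> v $ i = 0" using path by simp
  show "v $ 2 = 0" using vanish_step[OF v, of 5] path l by simp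
qed

text \<open>The restriction to \<open>{x\<^sub>1, x\<^sub>2, y\<^sub>2, y\<^sub>3}\<close> of the eigenvector equation for a vector
  that vanishes elsewhere.\<close>

definition core_eigvec :: "real \<Rightarrow> real vec \<Rightarrow> bool" where
  "core_eigvec ev v \<longleftrightarrow>
     (v $ 0 \<noteq> 0 \<or> v $ 1 \<noteq> 0 \<or> v $ 3 \<noteq> 0 \<or> v $ 4 \<noteq> 0) \<and>
     A $$ (0, 0) * v $ 0 + A $$ (0, 1) * v $ 1 + A $$ (0, 3) * v $ 3 + A $$ (0, 4) * v $ 4
       = ev * v $ 0 \<and>
     A $$ (0, 1) * v $ 0 + A $$ (1, 1) * v $ 1 + A $$ (1, 3) * v $ 3 + A $$ (1, 4) * v $ 4
       = ev * v $ 1 \<and>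
     A $$ (0, 2) * v $ 0 + A $$ (1, 2) * v $ 1 = 0 \<and>
     A $$ (0, 3) * v $ 0 + A $$ (1, 3) * v $ 1 = (ev - A $$ (3, 3)) * v $ 3 \<and>
     A $$ (0, 4) * v $ 0 + A $$ (1, 4) * v $ 1 = (ev - A $$ (4, 4)) * v $ 4"

lemma core_eigvecD:
  assumes "core_eigvec ev v"
  shows "v $ 0 \<noteq> 0 \<or> v $ 1 \<noteq> 0 \<or> v $ 3 \<noteq> 0 \<or> v $ 4 \<noteq> 0"
    and "A $$ (0, 0) * v $ 0 + A $$ (0, 1) * v $ 1 + A $$ (0, 3) * v $ 3 + A $$ (0, 4) * v $ 4
           = ev * v $ 0"
    and "A $$ (0, 1) * v $ 0 + A $$ (1, 1) * v $ 1 + A $$ (1, 3) * v $ 3 + A $$ (1, 4) * v $ 4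
           = ev * v $ 1"
    and "A $$ (0, 2) * v $ 0 + A $$ (1, 2) * v $ 1 = 0"
    and "A $$ (0, 3) * v $ 0 + A $$ (1, 3) * v $ 1 = (ev - A $$ (3, 3)) * v $ 3"
    and "A $$ (0, 4) * v $ 0 + A $$ (1, 4) * v $ 1 = (ev - A $$ (4, 4)) * v $ 4"
  using assms unfolding core_eigvec_def by blast+

text \<open>One further zero is imposed at the end of the path, whence the summand 1; it clears the
  path and \<open>y_1\<close>, and the remaining rows reduce to the core equations.\<close>

lemma core_eigvec_exists:
  assumes S: "S \<subseteq> {0, 1, 3, 4}" and card: "card S + 1 < Polynomial.order ev (char_poly A)"
  obtains v where "core_eigvec ev v" and "\<And>i. i \<in> S \<Longrightarrow> v $ i = 0"
proof -
  have "finite S" using S finite_subset by auto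
  then have "card (insert (l + 4) S) < Polynomial.order ev (char_poly A)"
    using card by (simp add: card_insert_if)
  moreover have "insert (l + 4) S \<subseteq> {0..<l + 5}" using S by auto
  ultimately obtain v where v: "v \<in> carrier_vec (l + 5)" "A *\<^sub>v v = ev \<cdot>\<^sub>v v"
    and nz: "v \<noteq> 0\<^sub>v (l + 5)" and zero: "\<And>i. i \<in> insert (l + 4) S \<Longrightarrow> v $ i = 0"
    using symmetric_eigenvector_vanishing[OF A sym] by metis
  note path = vanish_path[OF v zero[OF insertI1]]
  have "(\<Sum>j<l + 5. A $$ (i, j) * v $ j) = (\<Sum>j<5. A $$ (i, j) * v $ j)" for i
    by (rule sum.mono_neutral_right) (use path(1) in auto)
  then have row: "A $$ (i, 0) * v $ 0 + A $$ (i, 1) * v $ 1 + A $$ (i, 3) * v $ 3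
      + A $$ (i, 4) * v $ 4 = ev * v $ i" if "i < 5" for i
    using eigenvector_row[OF v, of i] that path(2) by (simp add: lessThan_nat_numeral)
  have y_entries: "A $$ (2, 3) = 0" "A $$ (2, 4) = 0" "A $$ (3, 4) = 0"
    using entry[of 2 3] entry[of 2 4] entry[of 3 4] by auto
  have syms: "A $$ (1, 0) = A $$ (0, 1)" "A $$ (2, 0) = A $$ (0, 2)" "A $$ (2, 1) = A $$ (1, 2)"
    "A $$ (3, 0) = A $$ (0, 3)" "A $$ (3, 1) = A $$ (1, 3)" "A $$ (4, 0) = A $$ (0, 4)"
    "A $$ (4, 1) = A $$ (1, 4)" "A $$ (4, 3) = A $$ (3, 4)"
    by (rule entry_sym; simp)+
  have nonzero: "v $ 0 \<noteq> 0 \<or> v $ 1 \<noteq> 0 \<or> v $ 3 \<noteq> 0 \<or> v $ 4 \<noteq> 0"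
  proof (rule ccontr)
    assume none: "\<not> ?thesis"
    have "v $ i = 0" if "i < l + 5" for i
    proof (cases "5 \<le> i")
      case False
      then have "i = 0 \<or> i = 1 \<or> i = 2 \<or> i = 3 \<or> i = 4" by linarith
      then show ?thesis using none path(2) by metis
    qed (use path(1) that in simp)
    then have "v = 0\<^sub>v (l + 5)" using v(1) by (intro eq_vecI) auto
    then show False using nz by simp
  qed
  \<comment> \<open>Row 2 becomes the orthogonality condition because \<open>v $ 2 = 0\<close>; rows
    3 and 4 keep just one diagonal term each, as the \<open>y\<close> vertices are pairwise
    nonadjacent.\<close>
  have "core_eigvec ev v"
    unfolding core_eigvec_def
    using nonzero row[of 0] row[of 1] row[of 2] row[of 3] row[of 4] path(2)
    by (simp only: syms y_entries) (simp add: algebra_simps)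
  then show ?thesis using that zero by blast
qed

section \<open>Bounds on the multiplicities\<close>

lemma K23_entries:
  "A $$ (0, 2) \<noteq> 0" "A $$ (1, 2) \<noteq> 0" "A $$ (0, 3) \<noteq> 0" "A $$ (0, 4) \<noteq> 0"
  using entry[of 0 2] entry[of 1 2] entry[of 0 3] entry[of 0 4] by auto

text \<open>With multiplicity 4, a core vector could be zero at \<open>x_1\<close> and
  \<open>y_2\<close>. The \<open>y_1\<close> row then kills it at \<open>x_2\<close> and the
  \<open>x_1\<close> row at \<open>y_3\<close>, leaving nothing.\<close>

lemma order_le_3: "Polynomial.order ev (char_poly A) \<le> 3"
proof (rule ccontr)
  assume "\<not> ?thesis"
  then have "card {0, 3 :: nat} + 1 < Polynomial.order ev (char_poly A)" by simp
  then obtain v where v: "core_eigvec ev v" and "\<And>i. i \<in> {0, 3} \<Longrightarrow> v $ i = 0"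
    by (rule core_eigvec_exists[rotated]) auto
  then have "v $ 0 = 0" "v $ 3 = 0" by auto
  then show False using core_eigvecD(1,2,4)[OF v] K23_entries by auto
qed

lemma order_3_order_le_1:
  assumes three: "3 \<le> Polynomial.order \<nu> (char_poly A)" and "\<nu> \<noteq> \<mu>"
  shows "Polynomial.order \<mu> (char_poly A) \<le> 1"
proof (rule ccontr)
  assume two: "\<not> ?thesis"
  obtain u where u: "core_eigvec \<nu> u" and "\<And>i. i \<in> {0} \<Longrightarrow> u $ i = 0"
    by (rule core_eigvec_exists[of "{0}" \<nu>]) (use three in auto)
  then have ux: "u $ 0 = 0" "u $ 1 = 0" using core_eigvecD(4)[OF u] K23_entries by auto
  \<comment> \<open>Row \<open>x_1\<close> is now a relation between \<open>u $ 3\<close> and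
    \<open>u $ 4\<close> with two nonzero coefficients; they are not both zero, so neither
    is.\<close>
  have "u $ 3 \<noteq> 0" "u $ 4 \<noteq> 0" using core_eigvecD(1,2)[OF u] ux K23_entries by auto
  then have diag: "A $$ (3, 3) = \<nu>" "A $$ (4, 4) = \<nu>" using core_eigvecD(5,6)[OF u] ux by auto

  obtain v where v: "core_eigvec \<nu> v" and "\<And>i. i \<in> {3} \<Longrightarrow> v $ i = 0"
    by (rule core_eigvec_exists[of "{3}" \<nu>]) (use three in auto)
  then have v3: "v $ 3 = 0" by simp
  \<comment> \<open>Otherwise \<open>v\<close> would vanish at \<open>x_1\<close> and
    \<open>y_2\<close>, which forces a core vector to be zero.\<close>
  have v0: "v $ 0 \<noteq> 0" using core_eigvecD(1,2,4)[OF v] v3 K23_entries by auto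
  have orth: "A $$ (0, 3) * v $ 0 + A $$ (1, 3) * v $ 1 = 0"
    "A $$ (0, 4) * v $ 0 + A $$ (1, 4) * v $ 1 = 0"
    using core_eigvecD(5,6)[OF v] diag by simp_all

  obtain w where w: "core_eigvec \<mu> w"
    by (rule core_eigvec_exists[of "{}" \<mu>]) (use two in auto)
  \<comment> \<open>The \<open>y_1\<close> row confines the \<open>x\<close>-parts of
    \<open>v\<close> and \<open>w\<close> to the same line; \<open>t\<close> is the ratio between
    them.\<close>
  define t where "t = w $ 0 / v $ 0"
  have w0: "w $ 0 = t * v $ 0" using v0 unfolding t_def by simp
  have "A $$ (1, 2) * (w $ 1 - t * v $ 1)
      = A $$ (0, 2) * w $ 0 + A $$ (1, 2) * w $ 1 - t * (A $$ (0, 2) * v $ 0 + A $$ (1, 2) * v $ 1)"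
    unfolding w0 by (simp add: algebra_simps)
  also have "\<dots> = 0" using core_eigvecD(4)[OF v] core_eigvecD(4)[OF w] by simp
  finally have w1: "w $ 1 = t * v $ 1" using K23_entries by simp
  \<comment> \<open>In the \<open>y_2\<close> and \<open>y_3\<close> rows of \<open>w\<close> the
    diagonal is \<nu>, and the left sides are multiples of the expressions in
    \<open>orth\<close>.\<close>
  have "(\<mu> - \<nu>) * w $ 3 = t * (A $$ (0, 3) * v $ 0 + A $$ (1, 3) * v $ 1)"
    "(\<mu> - \<nu>) * w $ 4 = t * (A $$ (0, 4) * v $ 0 + A $$ (1, 4) * v $ 1)"
    using core_eigvecD(5,6)[OF w] unfolding diag w0 w1 by (simp_all add: algebra_simps)
  then have wy: "w $ 3 = 0" "w $ 4 = 0" using orth \<open>\<nu> \<noteq> \<mu>\<close> by simp_all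
  have t: "t \<noteq> 0" using core_eigvecD(1)[OF w] w0 w1 wy by auto
  have "t * (A $$ (0, 0) * v $ 0 + A $$ (0, 1) * v $ 1) = t * (\<mu> * v $ 0)"
    "t * (A $$ (0, 1) * v $ 0 + A $$ (1, 1) * v $ 1) = t * (\<mu> * v $ 1)"
    using core_eigvecD(2,3)[OF w] unfolding w0 w1 wy by (simp_all add: algebra_simps)
  then have "A $$ (0, 0) * v $ 0 + A $$ (0, 1) * v $ 1 = \<mu> * v $ 0"
    "A $$ (0, 1) * v $ 0 + A $$ (1, 1) * v $ 1 = \<mu> * v $ 1"
    using t by (simp_all only: mult_cancel_left simp_thms)
  \<comment> \<open>The \<mu>-equations, transferred to the \<open>x\<close>-part of
    \<open>v\<close>, are subtracted from its \<nu>-equations; as \<open>v $ 3 = 0\<close>, only the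
    \<open>y_3\<close> term is left.\<close>
  then have y3: "A $$ (0, 4) * v $ 4 = (\<nu> - \<mu>) * v $ 0" "A $$ (1, 4) * v $ 4 = (\<nu> - \<mu>) * v $ 1"
    using core_eigvecD(2,3)[OF v] v3 by (simp_all add: left_diff_distrib)
  \<comment> \<open>Pairing with the \<open>x\<close>-part of \<open>v\<close> gives its squared
    norm on one side and, by orthogonality to the \<open>y_3\<close> row, zero on the other.\<close>
  have "(\<nu> - \<mu>) * (v $ 0 * v $ 0 + v $ 1 * v $ 1)
      = ((\<nu> - \<mu>) * v $ 0) * v $ 0 + ((\<nu> - \<mu>) * v $ 1) * v $ 1"
    by (simp add: algebra_simps)
  also have "\<dots> = v $ 4 * (A $$ (0, 4) * v $ 0 + A $$ (1, 4) * v $ 1)"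
    unfolding y3[symmetric] by (simp add: algebra_simps)
  also have "\<dots> = 0" unfolding orth(2) by simp
  finally have "(\<nu> - \<mu>) * (v $ 0 * v $ 0 + v $ 1 * v $ 1) = 0" .
  then show False using v0 \<open>\<nu> \<noteq> \<mu>\<close> by (auto simp: sum_squares_eq_zero_iff)
qed

end

theorem mainTheorem10:
  fixes l :: nat and E :: "nat set set" and A :: "real mat" and \<nu> \<mu> :: real
  assumes "l \<ge> 1"
    and "E = G_edges l \<or> E = G_plus_e_edges l"
    and "A \<in> sym_pattern_mats (G_order l) E"
    and "eigenvalue A \<nu>" and "eigenvalue A \<mu>" and "\<nu> \<noteq> \<mu>"
  shows "eig_mult A \<nu> + eig_mult A \<mu> \<le> 4"
proof -
  \<comment> \<open>The two graphs differ only in the edge between vertices 0 and 1.\<close>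
  have E: "{i, j} \<in> E \<longleftrightarrow> {i, j} \<in> G_edges l" if "i < j" "(i, j) \<noteq> (0, 1)" for i j
    proof -
    have "{i, j} \<noteq> {vx 1, vx 2}" using that unfolding vx_def by (auto simp: doubleton_eq_iff)
    then show ?thesis using assms(2) unfolding G_plus_e_edges_def by blast
  qed
  have pattern: "A \<in> carrier_mat (l + 5) (l + 5)" "transpose_mat A = A"
    "\<And>i j. i < l + 5 \<Longrightarrow> j < l + 5 \<Longrightarrow> i \<noteq> j \<Longrightarrow> A $$ (i, j) \<noteq> 0 \<longleftrightarrow> {i, j} \<in> E"
    using assms(3) unfolding sym_pattern_mats_def G_order_def by blast+
  interpret K23_path_mat l A
  proof
    show "1 \<le> l" by fact
    show "A \<in> carrier_mat (l + 5) (l + 5)" "transpose_mat A = A"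
      using pattern by blast+
    show "A $$ (i, j) \<noteq> 0 \<longleftrightarrow>
        i \<le> 1 \<and> 2 \<le> j \<and> j \<le> 4 \<or> i = 2 \<and> j = 5 \<or> 5 \<le> i \<and> j = i + 1"
      if "i < j" "j < l + 5" "(i, j) \<noteq> (0, 1)" for i j
    proof -
      have "A $$ (i, j) \<noteq> 0 \<longleftrightarrow> {i, j} \<in> E"
        using pattern(3)[of i j] that(1,2) by simp
      then show ?thesis unfolding E[OF that(1,3)] G_edges_iff[OF that(1)] using that(2) by blast
    qed
  qed
  \<comment> \<open>Either one multiplicity is 3 and the other at most 1, or both are at most
    2.\<close>
  have "3 \<le> eig_mult A \<nu> \<Longrightarrow> eig_mult A \<mu> \<le> 1" "3 \<le> eig_mult A \<mu> \<Longrightarrow> eig_mult A \<nu> \<le> 1"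
    using order_3_order_le_1 \<open>\<nu> \<noteq> \<mu>\<close> unfolding eig_mult_def by metis+
  moreover have "eig_mult A \<nu> \<le> 3" "eig_mult A \<mu> \<le> 3"
    using order_le_3 unfolding eig_mult_def by blast+
  ultimately show ?thesis by linarith
qed

end
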